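(* Let $\mathcal{A}$ be a consistent ABox, where $\mathcal{A}$ is either an LE-$\mathcal{ALC}$ input ABox (one containing none of the special individuals described in the context) or an ABox obtained from such an input ABox by finitely many applications of the expansion rules. Let $\mathcal{A}'$ be obtained from $\mathcal{A}$ via the application of any expansion rule. Then $\mathcal{A}'$ is also consistent.
   Context: **Syntax.** Fix disjoint sets $\mathsf{OBJ}$ and $\mathsf{FEAT}$ of individual names (objects $a,b$, resp. features $x,y$), a set $\mathcal{C}$ of atomic concept names, and role names: a single $I$, a finite set $\mathcal{R}_\Box$ of names $R_\Box$, and a finite set $\mathcal{R}_\Diamond$ of names $R_\Diamond$. LE-$\mathcal{ALC}$ concepts are $C ::= D \mid C_1\wedge C_2\mid C_1\vee C_2\mid \langle R_\Diamond\rangle C\mid [R_\Box]C$ with $D\in\mathcal{C}$, $R_\Box\in\mathcal{R}_\Box$, $R_\Diamond\in\mathcal{R}_\Diamond$. ABox terms are $aR_\Box x$, $xR_\Diamond a$, $aIx$ (these three are the relational terms), $a:C$, $x::C$, and $\neg\alpha$ for $\alpha$ any of the five preceding kinds. An ABox is a finite set of ABox terms. A concept $C'$ occurs in $\mathcal{A}$ if $C'$ is a subformula of some $C$ such that $a:C$, $x::C$, $\neg(a:C)$ or $\neg(x::C)$ is in $\mathcal{A}$ for some $a$ or $x$. **Semantics.** For $T\subseteq U\times V$, $U'\subseteq U$, $V'\subseteq V$: $T^{(1)}[U']=\{v\mid \forall u\in U',\ uTv\}$, $T^{(0)}[V']=\{u\mid\forall v\in V',\ uTv\}$ (for singletons write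 $T^{(1)}[u]$, $T^{(0)}[v]$). A formal context is $\mathbb{P}=(A,X,I)$ with $I\subseteq A\times X$; $B^\uparrow=I^{(1)}[B]$, $Y^\downarrow=I^{(0)}[Y]$. $B\subseteq A$ (resp. $Y\subseteq X$) is Galois-stable if $B^{\uparrow\downarrow}=B$ (resp. $Y^{\downarrow\uparrow}=Y$). A formal concept is $c=(B,Y)$ with $B=Y^\downarrow$, $Y=B^\uparrow$; write $[\![c]\!]=B$ and $(\![c]\!)=Y$. Formal concepts ordered by inclusion of $[\![\cdot]\!]$ form a complete lattice $\mathbb{P}^+$. An enriched formal context is $\mathbb{F}=(\mathbb{P},\mathcal{R}_\Box,\mathcal{R}_\Diamond)$ with relations $R_\Box\subseteq A\times X$, $R_\Diamond\subseteq X\times A$ that are $I$-compatible: $R_\Box^{(0)}[x],R_\Box^{(1)}[a],R_\Diamond^{(0)}[a],R_\Diamond^{(1)}[x]$ are Galois-stable for all $a\in A,x\in X$. Operations on $\mathbb{P}^+$: $[R_\Box]c$ is the formal concept with extension $R_\Box^{(0)}[(\![c]\!)]$, and $\langle R_\Diamond\rangle c$ is the formal concept with intension $R_\Diamond^{(0)}[[\![c]\!]]$. An interpretation $(\mathbb{F},\cdot^{\mathrm I})$ maps object (feature) names, including any special individuals, to elements of $A$ (of $X$), role names to the corresponding relations of $\mathbb{F}$, atomic concept names to elements of $\mathbb{P}^+$, and extends to concepts homomorphically ($\wedge,\vee$ as meet and join of $\mathbb{P}^+$, and $[R_\Box],\langle R_\Diamond\rangle$ as the operations above). Satisfaction: $a:C$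 iff $a^{\mathrm I}\in[\![C^{\mathrm I}]\!]$; $x::C$ iff $x^{\mathrm I}\in(\![C^{\mathrm I}]\!)$; relational terms iff the corresponding elements are so related; $\neg\alpha$ iff $\alpha$ is not satisfied. An interpretation is a model of an ABox if it satisfies all its terms; an ABox is consistent if it has a model. **Special individuals.** During expansion new individuals may be introduced: objects $a_C$ and features $x_C$ for concepts $C$; for each object $b$, objects $⧫ b$ (one for each $R_\Box$) and $\Diamond b$ (one for each $R_\Diamond$); for each feature $y$, features $\Box y$ (one for each $R_\Box$) and $\blacksquare y$ (one for each $R_\Diamond$). These are new and pairwise distinct (not occurring in the input ABox), except that $\Diamond a_C$ (for $R_\Diamond$) is $a_{\langle R_\Diamond\rangle C}$ and $\Box x_C$ (for $R_\Box$) is $x_{[R_\Box]C}$. **Expansion rules** (from the premises in the current ABox, add the conclusions; $b$ ranges over objects, $y$ and $x$ over features, and $\Box,⧫$ are those of the $R_\Box$ in the rule, $\Diamond,\blacksquare$ those of the $R_\Diamond$ in the rule): - creation: for any $C$ occurring in the current ABox, add $a_C:C$ and $x_C::C$; - basic ($I$): from $b:C$ and $y::C$ add $bIy$; - $\wedge_A$: from $b:C_1\wedge C_2$ add $b:C_1$, $b:C_2$; $\vee_X$: from $y::C_1\vee C_2$ add $y::C_1$, $y::C_2$; - $\Box$: from $b:[R_\Box]C$ and $y::C$ add $bR_\Box y$; $\Diamond$: from $y::\langle R_\Diamond\rangle C$ and $b:C$ add $yR_\Diamond b$; - $I$-compatibility: from $bI\Box y$ add $bR_\Box y$; from $bI\blacksquare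 y$ add $yR_\Diamond b$; from $\Diamond bIy$ add $yR_\Diamond b$; from $⧫ bIy$ add $bR_\Box y$; - $\wedge_A^{-1}$: from $b:C_1$ and $b:C_2$, if $C_1\wedge C_2$ occurs in the current ABox, add $b:C_1\wedge C_2$; $\vee_X^{-1}$: from $y::C_1$ and $y::C_2$, if $C_1\vee C_2$ occurs in the current ABox, add $y::C_1\vee C_2$; - adjunction: from $bR_\Box y$ add $⧫ bIy$ and $bI\Box y$; from $yR_\Diamond b$ add $\Diamond bIy$ and $bI\blacksquare y$; - negative: from $\neg(b:C)$ add $\neg(bIx_C)$; from $\neg(x::C)$ add $\neg(a_CIx)$; - appending: from $bIx_C$ add $b:C$; from $a_CIy$ add $y::C$. *)

theory Defs
  imports Main
begin

datatype ('c, 'rb, 'rd) concept =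
    Atom 'c
  | And "('c, 'rb, 'rd) concept" "('c, 'rb, 'rd) concept"
  | Or "('c, 'rb, 'rd) concept" "('c, 'rb, 'rd) concept"
  | Dia 'rd "('c, 'rb, 'rd) concept"
  | Box 'rb "('c, 'rb, 'rd) concept"

primrec subconcepts :: "('c, 'rb, 'rd) concept \<Rightarrow> ('c, 'rb, 'rd) concept set" where
  "subconcepts (Atom D) = {Atom D}"
| "subconcepts (And C1 C2) = insert (And C1 C2) (subconcepts C1 \<union> subconcepts C2)"
| "subconcepts (Or C1 C2) = insert (Or C1 C2) (subconcepts C1 \<union> subconcepts C2)"
| "subconcepts (Dia R C) = insert (Dia R C) (subconcepts C)"
| "subconcepts (Box R C) = insert (Box R C) (subconcepts C)"

text \<open>
  Individuals, with the special ones freely generated from the names in \<open>'o\<close> and \<open>'f\<close> up to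
  the two identifications \<open>\<diamond>a\<^sub>C = a\<^bsub>\<langle>R\<rangle>C\<^esub>\<close> and \<open>\<box>x\<^sub>C = x\<^bsub>[R]C\<^esub>\<close>. The types contain exactly one
  representative for each individual: \<open>ObjDia\<close> (\<open>FeatBox\<close>) cannot be applied directly to \<open>a\<^sub>C\<close>
  (\<open>x\<^sub>C\<close>); the total operations are \<open>dia_obj\<close> and \<open>box_feat\<close> below. \<open>ObjAdj R b\<close> is the black
  diamond of \<open>b\<close> for a box role, \<open>FeatAdj R y\<close> the black box of \<open>y\<close> for a diamond role.
\<close>

datatype ('o, 'c, 'rb, 'rd) obj =
    ObjConcept "('c, 'rb, 'rd) concept"
  | ObjProper "('o, 'c, 'rb, 'rd) proper_obj"
and ('o, 'c, 'rb, 'rd) proper_obj =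
    ObjName 'o
  | ObjAdj 'rb "('o, 'c, 'rb, 'rd) obj"
  | ObjDia 'rd "('o, 'c, 'rb, 'rd) proper_obj"

datatype ('f, 'c, 'rb, 'rd) feat =
    FeatConcept "('c, 'rb, 'rd) concept"
  | FeatProper "('f, 'c, 'rb, 'rd) proper_feat"
and ('f, 'c, 'rb, 'rd) proper_feat =
    FeatName 'f
  | FeatBox 'rb "('f, 'c, 'rb, 'rd) proper_feat"
  | FeatAdj 'rd "('f, 'c, 'rb, 'rd) feat"

definition bdia_obj :: "'rb \<Rightarrow> ('o, 'c, 'rb, 'rd) obj \<Rightarrow> ('o, 'c, 'rb, 'rd) obj" where
  "bdia_obj R b = ObjProper (ObjAdj R b)"

fun dia_obj :: "'rd \<Rightarrow> ('o, 'c, 'rb, 'rd) obj \<Rightarrow> ('o, 'c, 'rb, 'rd) obj" where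
  "dia_obj R (ObjConcept C) = ObjConcept (Dia R C)"
| "dia_obj R (ObjProper b) = ObjProper (ObjDia R b)"

fun box_feat :: "'rb \<Rightarrow> ('f, 'c, 'rb, 'rd) feat \<Rightarrow> ('f, 'c, 'rb, 'rd) feat" where
  "box_feat R (FeatConcept C) = FeatConcept (Box R C)"
| "box_feat R (FeatProper y) = FeatProper (FeatBox R y)"

definition bbox_feat :: "'rd \<Rightarrow> ('f, 'c, 'rb, 'rd) feat \<Rightarrow> ('f, 'c, 'rb, 'rd) feat" where
  "bbox_feat R y = FeatProper (FeatAdj R y)"

definition input_obj :: "('o, 'c, 'rb, 'rd) obj \<Rightarrow> bool" where
  "input_obj b \<longleftrightarrow> (\<exists>a. b = ObjProper (ObjName a))"

definition input_feat :: "('f, 'c, 'rb, 'rd) feat \<Rightarrow> bool" where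
  "input_feat y \<longleftrightarrow> (\<exists>x. y = FeatProper (FeatName x))"

datatype ('o, 'f, 'c, 'rb, 'rd) fact =
    BoxRel "('o, 'c, 'rb, 'rd) obj" 'rb "('f, 'c, 'rb, 'rd) feat"
  | DiaRel "('f, 'c, 'rb, 'rd) feat" 'rd "('o, 'c, 'rb, 'rd) obj"
  | IRel "('o, 'c, 'rb, 'rd) obj" "('f, 'c, 'rb, 'rd) feat"
  | ObjIn "('o, 'c, 'rb, 'rd) obj" "('c, 'rb, 'rd) concept"
  | FeatIn "('f, 'c, 'rb, 'rd) feat" "('c, 'rb, 'rd) concept"

datatype ('o, 'f, 'c, 'rb, 'rd) abox_term =
    Pos "('o, 'f, 'c, 'rb, 'rd) fact"
  | Neg "('o, 'f, 'c, 'rb, 'rd) fact"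

type_synonym ('o, 'f, 'c, 'rb, 'rd) abox = "('o, 'f, 'c, 'rb, 'rd) abox_term set"

primrec input_fact :: "('o, 'f, 'c, 'rb, 'rd) fact \<Rightarrow> bool" where
  "input_fact (BoxRel b R y) \<longleftrightarrow> input_obj b \<and> input_feat y"
| "input_fact (DiaRel y R b) \<longleftrightarrow> input_feat y \<and> input_obj b"
| "input_fact (IRel b y) \<longleftrightarrow> input_obj b \<and> input_feat y"
| "input_fact (ObjIn b C) \<longleftrightarrow> input_obj b"
| "input_fact (FeatIn y C) \<longleftrightarrow> input_feat y"

primrec input_term :: "('o, 'f, 'c, 'rb, 'rd) abox_term \<Rightarrow> bool" where
  "input_term (Pos \<alpha>) \<longleftrightarrow> input_fact \<alpha>"
| "input_term (Neg \<alpha>) \<longleftrightarrow> input_fact \<alpha>"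

definition input_abox :: "('o, 'f, 'c, 'rb, 'rd) abox \<Rightarrow> bool" where
  "input_abox \<A> \<longleftrightarrow> finite \<A> \<and> (\<forall>t\<in>\<A>. input_term t)"

definition occurs :: "('c, 'rb, 'rd) concept \<Rightarrow> ('o, 'f, 'c, 'rb, 'rd) abox \<Rightarrow> bool" where
  "occurs C' \<A> \<longleftrightarrow> (\<exists>C. C' \<in> subconcepts C \<and>
     ((\<exists>b. Pos (ObjIn b C) \<in> \<A> \<or> Neg (ObjIn b C) \<in> \<A>) \<or>
      (\<exists>y. Pos (FeatIn y C) \<in> \<A> \<or> Neg (FeatIn y C) \<in> \<A>)))"

text \<open>
  \<open>rel1 V T U'\<close> is \<open>T\<^sup>(\<^sup>1\<^sup>)[U']\<close> and \<open>rel0 U T V'\<close> is \<open>T\<^sup>(\<^sup>0\<^sup>)[V']\<close> for \<open>T \<subseteq> U \<times> V\<close>; the carrier of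
  the result is an argument because it matters when \<open>U'\<close> or \<open>V'\<close> is empty.
\<close>

definition rel1 :: "'v set \<Rightarrow> ('u \<times> 'v) set \<Rightarrow> 'u set \<Rightarrow> 'v set" where
  "rel1 V T U' = {v \<in> V. \<forall>u\<in>U'. (u, v) \<in> T}"

definition rel0 :: "'u set \<Rightarrow> ('u \<times> 'v) set \<Rightarrow> 'v set \<Rightarrow> 'u set" where
  "rel0 U T V' = {u \<in> U. \<forall>v\<in>V'. (u, v) \<in> T}"

record ('a, 'x) fcontext =
  objects :: "'a set"
  features :: "'x set"
  incidence :: "('a \<times> 'x) set"

definition formal_context :: "('a, 'x, 'z) fcontext_scheme \<Rightarrow> bool" where
  "formal_context P \<longleftrightarrow> incidence P \<subseteq> objects P \<times> features P"

definition up :: "('a, 'x, 'z) fcontext_scheme \<Rightarrow> 'a set \<Rightarrow> 'x set" where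
  "up P B = rel1 (features P) (incidence P) B"

definition down :: "('a, 'x, 'z) fcontext_scheme \<Rightarrow> 'x set \<Rightarrow> 'a set" where
  "down P Y = rel0 (objects P) (incidence P) Y"

definition stable_objs :: "('a, 'x, 'z) fcontext_scheme \<Rightarrow> 'a set \<Rightarrow> bool" where
  "stable_objs P B \<longleftrightarrow> B \<subseteq> objects P \<and> down P (up P B) = B"

definition stable_feats :: "('a, 'x, 'z) fcontext_scheme \<Rightarrow> 'x set \<Rightarrow> bool" where
  "stable_feats P Y \<longleftrightarrow> Y \<subseteq> features P \<and> up P (down P Y) = Y"

type_synonym ('a, 'x) fconcept = "'a set \<times> 'x set"

abbreviation extension :: "('a, 'x) fconcept \<Rightarrow> 'a set" where "extension \<equiv> fst"
abbreviation intension :: "('a, 'x) fconcept \<Rightarrow> 'x set" where "intension \<equiv> snd"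

definition formal_concept :: "('a, 'x, 'z) fcontext_scheme \<Rightarrow> ('a, 'x) fconcept \<Rightarrow> bool" where
  "formal_concept P c \<longleftrightarrow> extension c = down P (intension c) \<and> intension c = up P (extension c)"

definition concept_le :: "('a, 'x) fconcept \<Rightarrow> ('a, 'x) fconcept \<Rightarrow> bool" where
  "concept_le c d \<longleftrightarrow> extension c \<subseteq> extension d"

definition concept_meet ::
  "('a, 'x, 'z) fcontext_scheme \<Rightarrow> ('a, 'x) fconcept \<Rightarrow> ('a, 'x) fconcept \<Rightarrow> ('a, 'x) fconcept" where
  "concept_meet P c d = (extension c \<inter> extension d, up P (extension c \<inter> extension d))"

definition concept_join ::
  "('a, 'x, 'z) fcontext_scheme \<Rightarrow> ('a, 'x) fconcept \<Rightarrow> ('a, 'x) fconcept \<Rightarrow> ('a, 'x) fconcept" where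
  "concept_join P c d = (down P (intension c \<inter> intension d), intension c \<inter> intension d)"

text \<open>These are the binary meet and join of the lattice of formal concepts.\<close>

lemma down_up_galois: "B \<subseteq> objects P \<Longrightarrow> Y \<subseteq> features P \<Longrightarrow> B \<subseteq> down P Y \<longleftrightarrow> Y \<subseteq> up P B"
  unfolding up_def down_def rel0_def rel1_def by blast

lemma up_features: "up P B \<subseteq> features P" and down_objects: "down P Y \<subseteq> objects P"
  unfolding up_def down_def rel0_def rel1_def by blast+

lemma up_antimono: "B \<subseteq> B' \<Longrightarrow> up P B' \<subseteq> up P B"
  and down_antimono: "Y \<subseteq> Y' \<Longrightarrow> down P Y' \<subseteq> down P Y"
  unfolding up_def down_def rel0_def rel1_def by blast+

lemma down_up_superset: "B \<subseteq> objects P \<Longrightarrow> B \<subseteq> down P (up P B)"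
  and up_down_superset: "Y \<subseteq> features P \<Longrightarrow> Y \<subseteq> up P (down P Y)"
  using down_up_galois up_features down_objects by (metis order_refl)+

lemma formal_concept_subsets:
  assumes "formal_concept P c"
  shows "extension c \<subseteq> objects P" "intension c \<subseteq> features P"
  using assms up_features down_objects unfolding formal_concept_def by metis+

lemma concept_meet_glb:
  assumes "formal_concept P c" "formal_concept P d"
  shows "formal_concept P (concept_meet P c d)"
    and "concept_le (concept_meet P c d) c"
    and "concept_le (concept_meet P c d) d"
    and "\<And>e. concept_le e c \<Longrightarrow> concept_le e d \<Longrightarrow> concept_le e (concept_meet P c d)"
proof -
  let ?B = "extension c \<inter> extension d"
  have "down P (up P ?B) \<subseteq> down P (up P (extension e))" if "e \<in> {c, d}" for e
    using that by (intro down_antimono up_antimono) blast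
  then have "down P (up P ?B) \<subseteq> ?B"
    using assms unfolding formal_concept_def by (metis insertCI le_inf_iff)
  moreover have "?B \<subseteq> down P (up P ?B)"
    using formal_concept_subsets(1)[OF assms(1)] by (intro down_up_superset) blast
  ultimately show "formal_concept P (concept_meet P c d)"
    unfolding formal_concept_def concept_meet_def fst_conv snd_conv by blast
qed (simp_all add: concept_meet_def concept_le_def)

lemma concept_join_lub:
  assumes "formal_concept P c" "formal_concept P d"
  shows "formal_concept P (concept_join P c d)"
    and "concept_le c (concept_join P c d)"
    and "concept_le d (concept_join P c d)"
    and "\<And>e. formal_concept P e \<Longrightarrow> concept_le c e \<Longrightarrow> concept_le d e
           \<Longrightarrow> concept_le (concept_join P c d) e"
proof -
  let ?Y = "intension c \<inter> intension d"
  have "up P (down P ?Y) \<subseteq> up P (down P (intension e))" if "e \<in> {c, d}" for e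
    using that by (intro down_antimono up_antimono) blast
  then have "up P (down P ?Y) \<subseteq> ?Y"
    using assms unfolding formal_concept_def by (metis insertCI le_inf_iff)
  moreover have "?Y \<subseteq> up P (down P ?Y)"
    using formal_concept_subsets(2)[OF assms(1)] by (intro up_down_superset) blast
  ultimately show "formal_concept P (concept_join P c d)"
    unfolding formal_concept_def concept_join_def fst_conv snd_conv by blast
  have "down P (intension e) \<subseteq> down P ?Y" if "e \<in> {c, d}" for e
    using that by (intro down_antimono) blast
  then show "concept_le c (concept_join P c d)" "concept_le d (concept_join P c d)"
    using assms unfolding formal_concept_def concept_le_def concept_join_def
    by (metis fst_conv insertCI)+
  fix e assume e: "formal_concept P e" "concept_le c e" "concept_le d e"
  then have "up P (extension e) \<subseteq> up P (extension c) \<inter> up P (extension d)"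
    unfolding concept_le_def by (intro Int_greatest up_antimono)
  then have "down P ?Y \<subseteq> down P (intension e)"
    using assms e(1) unfolding formal_concept_def by (metis down_antimono)
  then show "concept_le (concept_join P c d) e"
    using e(1) unfolding formal_concept_def concept_le_def concept_join_def by (metis fst_conv)
qed

record ('a, 'x, 'rb, 'rd) enriched = "('a, 'x) fcontext" +
  rbox :: "'rb \<Rightarrow> ('a \<times> 'x) set"
  rdia :: "'rd \<Rightarrow> ('x \<times> 'a) set"

definition box_compatible :: "('a, 'x, 'z) fcontext_scheme \<Rightarrow> ('a \<times> 'x) set \<Rightarrow> bool" where
  "box_compatible P R \<longleftrightarrow>
     (\<forall>x\<in>features P. stable_objs P (rel0 (objects P) R {x})) \<and>
     (\<forall>a\<in>objects P. stable_feats P (rel1 (features P) R {a}))"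

definition dia_compatible :: "('a, 'x, 'z) fcontext_scheme \<Rightarrow> ('x \<times> 'a) set \<Rightarrow> bool" where
  "dia_compatible P R \<longleftrightarrow>
     (\<forall>a\<in>objects P. stable_feats P (rel0 (features P) R {a})) \<and>
     (\<forall>x\<in>features P. stable_objs P (rel1 (objects P) R {x}))"

definition enriched_formal_context :: "('a, 'x, 'rb, 'rd, 'z) enriched_scheme \<Rightarrow> bool" where
  "enriched_formal_context F \<longleftrightarrow> formal_context F \<and>
     (\<forall>R. rbox F R \<subseteq> objects F \<times> features F \<and> box_compatible F (rbox F R)) \<and>
     (\<forall>R. rdia F R \<subseteq> features F \<times> objects F \<and> dia_compatible F (rdia F R))"

definition concept_box ::
  "('a, 'x, 'rb, 'rd, 'z) enriched_scheme \<Rightarrow> 'rb \<Rightarrow> ('a, 'x) fconcept \<Rightarrow> ('a, 'x) fconcept" where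
  "concept_box F R c =
     (let B = rel0 (objects F) (rbox F R) (intension c) in (B, up F B))"

definition concept_dia ::
  "('a, 'x, 'rb, 'rd, 'z) enriched_scheme \<Rightarrow> 'rd \<Rightarrow> ('a, 'x) fconcept \<Rightarrow> ('a, 'x) fconcept" where
  "concept_dia F R c =
     (let Y = rel0 (features F) (rdia F R) (extension c) in (down F Y, Y))"

lemma formal_concept_box:
  assumes "enriched_formal_context F" "formal_concept F c"
  shows "formal_concept F (concept_box F R c)"
proof -
  let ?S = "\<lambda>Y. rel0 (objects F) (rbox F R) Y"
  let ?B = "?S (intension c)"
  have "down F (up F ?B) \<subseteq> ?S {x}" if x: "x \<in> intension c" for x
  proof -
    have "?B \<subseteq> ?S {x}" using x unfolding rel0_def by blast
    then have "down F (up F ?B) \<subseteq> down F (up F (?S {x}))"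
      by (intro down_antimono up_antimono)
    also have "\<dots> = ?S {x}"
      using assms(1) formal_concept_subsets(2)[OF assms(2)] x
      unfolding enriched_formal_context_def box_compatible_def stable_objs_def by blast
    finally show ?thesis .
  qed
  then have "down F (up F ?B) \<subseteq> ?B"
    using down_objects[of F "up F ?B"] unfolding rel0_def by blast
  moreover have "?B \<subseteq> down F (up F ?B)"
    by (intro down_up_superset) (simp add: rel0_def)
  ultimately show ?thesis by (simp add: formal_concept_def concept_box_def Let_def)
qed

lemma formal_concept_dia:
  assumes "enriched_formal_context F" "formal_concept F c"
  shows "formal_concept F (concept_dia F R c)"
proof -
  let ?S = "\<lambda>B. rel0 (features F) (rdia F R) B"
  let ?Y = "?S (extension c)"
  have "up F (down F ?Y) \<subseteq> ?S {a}" if a: "a \<in> extension c" for a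
  proof -
    have "?Y \<subseteq> ?S {a}" using a unfolding rel0_def by blast
    then have "up F (down F ?Y) \<subseteq> up F (down F (?S {a}))"
      by (intro down_antimono up_antimono)
    also have "\<dots> = ?S {a}"
      using assms(1) formal_concept_subsets(1)[OF assms(2)] a
      unfolding enriched_formal_context_def dia_compatible_def stable_feats_def by blast
    finally show ?thesis .
  qed
  then have "up F (down F ?Y) \<subseteq> ?Y"
    using up_features[of F "down F ?Y"] unfolding rel0_def by blast
  moreover have "?Y \<subseteq> up F (down F ?Y)"
    by (intro up_down_superset) (simp add: rel0_def)
  ultimately show ?thesis by (simp add: formal_concept_def concept_dia_def Let_def)
qed

record ('o, 'f, 'c, 'rb, 'rd, 'a, 'x) interp = "('a, 'x, 'rb, 'rd) enriched" +
  iobj :: "('o, 'c, 'rb, 'rd) obj \<Rightarrow> 'a"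
  ifeat :: "('f, 'c, 'rb, 'rd) feat \<Rightarrow> 'x"
  iatom :: "'c \<Rightarrow> ('a, 'x) fconcept"

definition is_interpretation :: "('o, 'f, 'c, 'rb, 'rd, 'a, 'x) interp \<Rightarrow> bool" where
  "is_interpretation M \<longleftrightarrow> enriched_formal_context M \<and>
     (\<forall>b. iobj M b \<in> objects M) \<and> (\<forall>y. ifeat M y \<in> features M) \<and>
     (\<forall>D. formal_concept M (iatom M D))"

primrec iconcept ::
  "('o, 'f, 'c, 'rb, 'rd, 'a, 'x) interp \<Rightarrow> ('c, 'rb, 'rd) concept \<Rightarrow> ('a, 'x) fconcept" where
  "iconcept M (Atom D) = iatom M D"
| "iconcept M (And C1 C2) = concept_meet M (iconcept M C1) (iconcept M C2)"
| "iconcept M (Or C1 C2) = concept_join M (iconcept M C1) (iconcept M C2)"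
| "iconcept M (Dia R C) = concept_dia M R (iconcept M C)"
| "iconcept M (Box R C) = concept_box M R (iconcept M C)"

primrec sat_fact ::
  "('o, 'f, 'c, 'rb, 'rd, 'a, 'x) interp \<Rightarrow> ('o, 'f, 'c, 'rb, 'rd) fact \<Rightarrow> bool" where
  "sat_fact M (BoxRel b R y) \<longleftrightarrow> (iobj M b, ifeat M y) \<in> rbox M R"
| "sat_fact M (DiaRel y R b) \<longleftrightarrow> (ifeat M y, iobj M b) \<in> rdia M R"
| "sat_fact M (IRel b y) \<longleftrightarrow> (iobj M b, ifeat M y) \<in> incidence M"
| "sat_fact M (ObjIn b C) \<longleftrightarrow> iobj M b \<in> extension (iconcept M C)"
| "sat_fact M (FeatIn y C) \<longleftrightarrow> ifeat M y \<in> intension (iconcept M C)"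

primrec sat ::
  "('o, 'f, 'c, 'rb, 'rd, 'a, 'x) interp \<Rightarrow> ('o, 'f, 'c, 'rb, 'rd) abox_term \<Rightarrow> bool" where
  "sat M (Pos \<alpha>) \<longleftrightarrow> sat_fact M \<alpha>"
| "sat M (Neg \<alpha>) \<longleftrightarrow> \<not> sat_fact M \<alpha>"

text \<open>
  HOL cannot quantify over the types that \<open>A\<close> and \<open>X\<close> are drawn from inside a formula, so
  consistency is indexed by them: \<open>consistent TYPE('a) TYPE('x) \<A>\<close> says that \<open>\<A>\<close> has a model
  whose sets of objects and features are subsets of \<open>'a\<close> and \<open>'x\<close>. As a hypothesis, with \<open>'a\<close>
  and \<open>'x\<close> free type variables, it covers models of every size; as a conclusion it is stated for the types
  of individuals, whose elements suffice as the objects and features of a model.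
\<close>

definition consistent ::
  "'a itself \<Rightarrow> 'x itself \<Rightarrow> ('o, 'f, 'c, 'rb, 'rd) abox \<Rightarrow> bool" where
  "consistent (_ :: 'a itself) (_ :: 'x itself) \<A> \<longleftrightarrow>
     (\<exists>M :: ('o, 'f, 'c, 'rb, 'rd, 'a, 'x) interp. is_interpretation M \<and> (\<forall>t\<in>\<A>. sat M t))"

inductive expand ::
  "('o, 'f, 'c, 'rb, 'rd) abox \<Rightarrow> ('o, 'f, 'c, 'rb, 'rd) abox \<Rightarrow> bool" where
  create: "occurs C \<A> \<Longrightarrow>
     expand \<A> (\<A> \<union> {Pos (ObjIn (ObjConcept C) C), Pos (FeatIn (FeatConcept C) C)})"
| basic: "Pos (ObjIn b C) \<in> \<A> \<Longrightarrow> Pos (FeatIn y C) \<in> \<A> \<Longrightarrow> expand \<A> (\<A> \<union> {Pos (IRel b y)})"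
| and_A: "Pos (ObjIn b (And C1 C2)) \<in> \<A> \<Longrightarrow>
     expand \<A> (\<A> \<union> {Pos (ObjIn b C1), Pos (ObjIn b C2)})"
| or_X: "Pos (FeatIn y (Or C1 C2)) \<in> \<A> \<Longrightarrow>
     expand \<A> (\<A> \<union> {Pos (FeatIn y C1), Pos (FeatIn y C2)})"
| box: "Pos (ObjIn b (Box R C)) \<in> \<A> \<Longrightarrow> Pos (FeatIn y C) \<in> \<A> \<Longrightarrow>
     expand \<A> (\<A> \<union> {Pos (BoxRel b R y)})"
| dia: "Pos (FeatIn y (Dia R C)) \<in> \<A> \<Longrightarrow> Pos (ObjIn b C) \<in> \<A> \<Longrightarrow>
     expand \<A> (\<A> \<union> {Pos (DiaRel y R b)})"
| compat_box: "Pos (IRel b (box_feat R y)) \<in> \<A> \<Longrightarrow> expand \<A> (\<A> \<union> {Pos (BoxRel b R y)})"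
| compat_bbox: "Pos (IRel b (bbox_feat R y)) \<in> \<A> \<Longrightarrow> expand \<A> (\<A> \<union> {Pos (DiaRel y R b)})"
| compat_dia: "Pos (IRel (dia_obj R b) y) \<in> \<A> \<Longrightarrow> expand \<A> (\<A> \<union> {Pos (DiaRel y R b)})"
| compat_bdia: "Pos (IRel (bdia_obj R b) y) \<in> \<A> \<Longrightarrow> expand \<A> (\<A> \<union> {Pos (BoxRel b R y)})"
| and_A_inv: "Pos (ObjIn b C1) \<in> \<A> \<Longrightarrow> Pos (ObjIn b C2) \<in> \<A> \<Longrightarrow> occurs (And C1 C2) \<A> \<Longrightarrow>
     expand \<A> (\<A> \<union> {Pos (ObjIn b (And C1 C2))})"
| or_X_inv: "Pos (FeatIn y C1) \<in> \<A> \<Longrightarrow> Pos (FeatIn y C2) \<in> \<A> \<Longrightarrow> occurs (Or C1 C2) \<A> \<Longrightarrow>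
     expand \<A> (\<A> \<union> {Pos (FeatIn y (Or C1 C2))})"
| adj_box: "Pos (BoxRel b R y) \<in> \<A> \<Longrightarrow>
     expand \<A> (\<A> \<union> {Pos (IRel (bdia_obj R b) y), Pos (IRel b (box_feat R y))})"
| adj_dia: "Pos (DiaRel y R b) \<in> \<A> \<Longrightarrow>
     expand \<A> (\<A> \<union> {Pos (IRel (dia_obj R b) y), Pos (IRel b (bbox_feat R y))})"
| neg_obj: "Neg (ObjIn b C) \<in> \<A> \<Longrightarrow> expand \<A> (\<A> \<union> {Neg (IRel b (FeatConcept C))})"
| neg_feat: "Neg (FeatIn x C) \<in> \<A> \<Longrightarrow> expand \<A> (\<A> \<union> {Neg (IRel (ObjConcept C) x)})"
| append_obj: "Pos (IRel b (FeatConcept C)) \<in> \<A> \<Longrightarrow> expand \<A> (\<A> \<union> {Pos (ObjIn b C)})"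
| append_feat: "Pos (IRel (ObjConcept C) y) \<in> \<A> \<Longrightarrow> expand \<A> (\<A> \<union> {Pos (FeatIn y C)})"

end

theory Submission
  imports Defs
begin

text \<open>
  Soundness of an expansion rule cannot be read off from an arbitrary model of the current ABox,
  since that model may interpret the special individuals badly: nothing forces \<open>a\<^sub>C\<close> to generate
  the concept \<open>C\<close>, nor \<open>\<box>y\<close> to be related by \<open>I\<close> to exactly the objects that are \<open>R\<^sub>\<box>\<close>-related
  to \<open>y\<close>. The remedy is to go back to the input ABox, whose terms speak of named individuals only,
  and to rebuild its model so that every special individual means what its name suggests.

  Let \<open>M\<close> be a model of the input ABox and \<open>L\<close> its lattice of formal concepts. On \<open>L\<close> each \<open>[R\<^sub>\<box>]\<close>
  has a left adjoint and each \<open>\<langle>R\<^sub>\<diamond>\<rangle>\<close> a right adjoint; this is where \<open>I\<close>-compatibility enters.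
  Hence every individual denotes an element of \<open>L\<close>: a name denotes the concept it
  generates in \<open>M\<close>, the individuals \<open>a\<^sub>C\<close> and \<open>x\<^sub>C\<close> denote the value of \<open>C\<close>, and the modal prefixes
  denote the modal operators and their adjoints (\<open>obj_value\<close>, \<open>feat_value\<close>).

  The canonical model has all individuals as its objects and features. An object is incident to a
  feature if its value lies below the value of the feature, and \<open>b R\<^sub>\<box> y\<close>, \<open>y R\<^sub>\<diamond> b\<close> mean
  \<open>b \<le> [R\<^sub>\<box>]y\<close> and \<open>\<langle>R\<^sub>\<diamond>\<rangle>b \<le> y\<close> for the values. Two facts carry the argument.
  Every set \<open>R\<^sup>(\<^sup>0\<^sup>)[v]\<close> or \<open>R\<^sup>(\<^sup>1\<^sup>)[u]\<close> of the canonical model is the polar of a single individual,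
  namely one with a modal prefix, and so is Galois-stable.
  And a concept \<open>C\<close> has as extension the objects with value below the value of \<open>C\<close> in \<open>M\<close>
  (and dually), because \<open>a\<^sub>C\<close> and \<open>x\<^sub>C\<close> are present to generate it (\<open>iconcept_canonical\<close>).
  On terms about names the canonical model therefore agrees with \<open>M\<close>, so it is a model of the
  input ABox; and every expansion rule is sound in it (\<open>expand_sound\<close>). It is thus a model of
  every ABox that can be reached from the input ABox.
\<close>

section \<open>Generated concepts and adjoints of the modal operators\<close>

definition obj_gen :: "('a, 'x, 'z) fcontext_scheme \<Rightarrow> 'a \<Rightarrow> ('a, 'x) fconcept" where
  "obj_gen P a = (down P (up P {a}), up P {a})"

definition feat_gen :: "('a, 'x, 'z) fcontext_scheme \<Rightarrow> 'x \<Rightarrow> ('a, 'x) fconcept" where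
  "feat_gen P x = (down P {x}, up P (down P {x}))"

text \<open>The left adjoint of \<^const>\<open>concept_box\<close> and the right adjoint of \<^const>\<open>concept_dia\<close>.\<close>

definition concept_bdia ::
  "('a, 'x, 'rb, 'rd, 'z) enriched_scheme \<Rightarrow> 'rb \<Rightarrow> ('a, 'x) fconcept \<Rightarrow> ('a, 'x) fconcept" where
  "concept_bdia F R c =
     (let Y = rel1 (features F) (rbox F R) (extension c) in (down F Y, Y))"

definition concept_bbox ::
  "('a, 'x, 'rb, 'rd, 'z) enriched_scheme \<Rightarrow> 'rd \<Rightarrow> ('a, 'x) fconcept \<Rightarrow> ('a, 'x) fconcept" where
  "concept_bbox F R c =
     (let B = rel1 (objects F) (rdia F R) (intension c) in (B, up F B))"

lemma concept_le_refl: "concept_le c c"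
  and concept_le_trans: "concept_le c d \<Longrightarrow> concept_le d e \<Longrightarrow> concept_le c e"
  unfolding concept_le_def by blast+

lemma concept_le_intension:
  assumes "formal_concept P c" "formal_concept P d"
  shows "concept_le c d \<longleftrightarrow> intension d \<subseteq> intension c"
  using assms up_antimono down_antimono unfolding formal_concept_def concept_le_def by metis

lemma formal_concept_obj_gen:
  assumes "a \<in> objects P"
  shows "formal_concept P (obj_gen P a)"
proof -
  have "up P (down P (up P {a})) \<subseteq> up P {a}"
    using assms by (intro up_antimono down_up_superset) simp
  then show ?thesis
    using up_down_superset[OF up_features[of P "{a}"]]
    by (simp add: formal_concept_def obj_gen_def)
qed

lemma formal_concept_feat_gen:
  assumes "x \<in> features P"
  shows "formal_concept P (feat_gen P x)"
proof -
  have "down P (up P (down P {x})) \<subseteq> down P {x}"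
    using assms by (intro down_antimono up_down_superset) simp
  then show ?thesis
    using down_up_superset[OF down_objects[of P "{x}"]]
    by (simp add: formal_concept_def feat_gen_def)
qed

lemma obj_gen_le:
  assumes "a \<in> objects P" "formal_concept P c"
  shows "concept_le (obj_gen P a) c \<longleftrightarrow> a \<in> extension c"
proof -
  have "concept_le (obj_gen P a) c \<longleftrightarrow> intension c \<subseteq> up P {a}"
    using concept_le_intension[OF formal_concept_obj_gen[OF assms(1)] assms(2)]
    by (simp add: obj_gen_def)
  also have "\<dots> \<longleftrightarrow> {a} \<subseteq> down P (intension c)"
    using assms(1) formal_concept_subsets(2)[OF assms(2)]
    by (intro down_up_galois[symmetric]) simp_all
  also have "down P (intension c) = extension c"
    using assms(2) unfolding formal_concept_def by (elim conjE) (rule sym)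
  finally show ?thesis by simp
qed

lemma feat_gen_ge:
  assumes "x \<in> features P" "formal_concept P c"
  shows "concept_le c (feat_gen P x) \<longleftrightarrow> x \<in> intension c"
proof -
  have "concept_le c (feat_gen P x) \<longleftrightarrow> extension c \<subseteq> down P {x}"
    by (simp add: concept_le_def feat_gen_def)
  also have "\<dots> \<longleftrightarrow> {x} \<subseteq> up P (extension c)"
    using assms(1) formal_concept_subsets(1)[OF assms(2)] by (intro down_up_galois) simp_all
  also have "up P (extension c) = intension c"
    using assms(2) unfolding formal_concept_def by (elim conjE) (rule sym)
  finally show ?thesis by simp
qed

text \<open>Intersections of Galois-stable sets are Galois-stable, and \<open>R\<^sub>\<box>\<^sup>(\<^sup>1\<^sup>)[B]\<close> is the
  intersection of the sets \<open>R\<^sub>\<box>\<^sup>(\<^sup>1\<^sup>)[a]\<close> for \<open>a \<in> B\<close>; similarly for \<open>R\<^sub>\<diamond>\<close>.\<close>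

lemma formal_concept_bdia:
  assumes "enriched_formal_context F" "formal_concept F c"
  shows "formal_concept F (concept_bdia F R c)"
proof -
  let ?S = "\<lambda>B. rel1 (features F) (rbox F R) B"
  let ?Y = "?S (extension c)"
  have "up F (down F ?Y) \<subseteq> ?S {a}" if a: "a \<in> extension c" for a
  proof -
    have "?Y \<subseteq> ?S {a}" using a unfolding rel1_def by blast
    then have "up F (down F ?Y) \<subseteq> up F (down F (?S {a}))"
      by (intro down_antimono up_antimono)
    also have "\<dots> = ?S {a}"
      using assms(1) formal_concept_subsets(1)[OF assms(2)] a
      unfolding enriched_formal_context_def box_compatible_def stable_feats_def by blast
    finally show ?thesis .
  qed
  then have "up F (down F ?Y) \<subseteq> ?Y"
    using up_features[of F "down F ?Y"] unfolding rel1_def by blast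
  moreover have "?Y \<subseteq> up F (down F ?Y)"
    by (intro up_down_superset) (simp add: rel1_def)
  ultimately show ?thesis by (simp add: formal_concept_def concept_bdia_def Let_def)
qed

lemma formal_concept_bbox:
  assumes "enriched_formal_context F" "formal_concept F c"
  shows "formal_concept F (concept_bbox F R c)"
proof -
  let ?S = "\<lambda>Y. rel1 (objects F) (rdia F R) Y"
  let ?B = "?S (intension c)"
  have "down F (up F ?B) \<subseteq> ?S {x}" if x: "x \<in> intension c" for x
  proof -
    have "?B \<subseteq> ?S {x}" using x unfolding rel1_def by blast
    then have "down F (up F ?B) \<subseteq> down F (up F (?S {x}))"
      by (intro down_antimono up_antimono)
    also have "\<dots> = ?S {x}"
      using assms(1) formal_concept_subsets(2)[OF assms(2)] x
      unfolding enriched_formal_context_def dia_compatible_def stable_objs_def by blast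
    finally show ?thesis .
  qed
  then have "down F (up F ?B) \<subseteq> ?B"
    using down_objects[of F "up F ?B"] unfolding rel1_def by blast
  moreover have "?B \<subseteq> down F (up F ?B)"
    by (intro down_up_superset) (simp add: rel1_def)
  ultimately show ?thesis by (simp add: formal_concept_def concept_bbox_def Let_def)
qed

text \<open>Comparing on the side where the operator is a polar, both inequalities say that
  every object in the extension of \<open>c\<close> is \<open>R\<close>-related to every feature in the intension of
  \<open>d\<close>.\<close>

lemma bdia_box_adjoint:
  assumes "enriched_formal_context F" "formal_concept F c" "formal_concept F d"
  shows "concept_le (concept_bdia F R c) d \<longleftrightarrow> concept_le c (concept_box F R d)"
proof -
  have "concept_le (concept_bdia F R c) d
      \<longleftrightarrow> intension d \<subseteq> rel1 (features F) (rbox F R) (extension c)"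
    using concept_le_intension[OF formal_concept_bdia[OF assms(1,2)] assms(3)]
    by (simp add: concept_bdia_def Let_def)
  also have "\<dots> \<longleftrightarrow> extension c \<subseteq> rel0 (objects F) (rbox F R) (intension d)"
    using formal_concept_subsets[OF assms(2)] formal_concept_subsets[OF assms(3)]
    unfolding rel0_def rel1_def by blast
  finally show ?thesis
    by (simp add: concept_le_def concept_box_def Let_def)
qed

lemma dia_bbox_adjoint:
  assumes "enriched_formal_context F" "formal_concept F c" "formal_concept F d"
  shows "concept_le (concept_dia F R c) d \<longleftrightarrow> concept_le c (concept_bbox F R d)"
proof -
  have "concept_le (concept_dia F R c) d
      \<longleftrightarrow> intension d \<subseteq> rel0 (features F) (rdia F R) (extension c)"
    using concept_le_intension[OF formal_concept_dia[OF assms(1,2)] assms(3)]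
    by (simp add: concept_dia_def Let_def)
  also have "\<dots> \<longleftrightarrow> extension c \<subseteq> rel1 (objects F) (rdia F R) (intension d)"
    using formal_concept_subsets[OF assms(2)] formal_concept_subsets[OF assms(3)]
    unfolding rel0_def rel1_def by blast
  finally show ?thesis
    by (simp add: concept_le_def concept_bbox_def Let_def)
qed

lemma concept_box_mono:
  "formal_concept F c \<Longrightarrow> formal_concept F d \<Longrightarrow> concept_le c d \<Longrightarrow>
   concept_le (concept_box F R c) (concept_box F R d)"
  by (auto simp: concept_le_intension)
    (auto simp: concept_le_def concept_box_def rel0_def Let_def)

lemma concept_dia_mono:
  "concept_le c d \<Longrightarrow> concept_le (concept_dia F R c) (concept_dia F R d)"
  unfolding concept_le_def concept_dia_def Let_def fst_conv
  by (rule down_antimono) (auto simp: rel0_def)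

text \<open>On generators, \<open>b \<le> [R]y\<close> and \<open>\<langle>R\<rangle>b \<le> y\<close> give back the relations themselves: by
  \<open>I\<close>-compatibility the closure of \<open>{y}\<close> (of \<open>{b}\<close>) adds no further condition.\<close>

lemma obj_gen_le_box_feat_gen:
  assumes "enriched_formal_context F" "a \<in> objects F" "x \<in> features F"
  shows "concept_le (obj_gen F a) (concept_box F R (feat_gen F x)) \<longleftrightarrow> (a, x) \<in> rbox F R"
proof -
  note fx = formal_concept_feat_gen[OF assms(3)]
  let ?Y = "up F (down F {x})" and ?T = "rel1 (features F) (rbox F R) {a}"
  have stable: "up F (down F ?T) = ?T"
    using assms unfolding enriched_formal_context_def box_compatible_def stable_feats_def by blast
  have "concept_le (obj_gen F a) (concept_box F R (feat_gen F x))
      \<longleftrightarrow> a \<in> rel0 (objects F) (rbox F R) ?Y"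
    using obj_gen_le[OF assms(2) formal_concept_box[OF assms(1) fx]]
    by (simp add: concept_box_def feat_gen_def Let_def)
  also have "\<dots> \<longleftrightarrow> ?Y \<subseteq> ?T"
    using assms(2) up_features[of F "down F {x}"] by (auto simp: rel0_def rel1_def)
  also have "\<dots> \<longleftrightarrow> {x} \<subseteq> ?T"
  proof
    assume "?Y \<subseteq> ?T"
    then show "{x} \<subseteq> ?T" using up_down_superset[of "{x}" F] assms(3) by blast
  next
    assume "{x} \<subseteq> ?T"
    then have "?Y \<subseteq> up F (down F ?T)" by (intro up_antimono down_antimono)
    then show "?Y \<subseteq> ?T" by (simp only: stable)
  qed
  finally show ?thesis using assms(3) by (simp add: rel1_def)
qed

lemma dia_obj_gen_le_feat_gen:
  assumes "enriched_formal_context F" "a \<in> objects F" "x \<in> features F"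
  shows "concept_le (concept_dia F R (obj_gen F a)) (feat_gen F x) \<longleftrightarrow> (x, a) \<in> rdia F R"
proof -
  note fa = formal_concept_obj_gen[OF assms(2)]
  let ?B = "down F (up F {a})" and ?T = "rel1 (objects F) (rdia F R) {x}"
  have stable: "down F (up F ?T) = ?T"
    using assms unfolding enriched_formal_context_def dia_compatible_def stable_objs_def by blast
  have "concept_le (concept_dia F R (obj_gen F a)) (feat_gen F x)
      \<longleftrightarrow> x \<in> rel0 (features F) (rdia F R) ?B"
    using feat_gen_ge[OF assms(3) formal_concept_dia[OF assms(1) fa]]
    by (simp add: concept_dia_def obj_gen_def Let_def)
  also have "\<dots> \<longleftrightarrow> ?B \<subseteq> ?T"
    using assms(3) down_objects[of F "up F {a}"] by (auto simp: rel0_def rel1_def)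
  also have "\<dots> \<longleftrightarrow> {a} \<subseteq> ?T"
  proof
    assume "?B \<subseteq> ?T"
    then show "{a} \<subseteq> ?T" using down_up_superset[of "{a}" F] assms(2) by blast
  next
    assume "{a} \<subseteq> ?T"
    then have "?B \<subseteq> down F (up F ?T)" by (intro down_antimono up_antimono)
    then show "?B \<subseteq> ?T" by (simp only: stable)
  qed
  finally show ?thesis using assms(2) by (simp add: rel1_def)
qed

lemma formal_concept_iconcept:
  assumes "is_interpretation M"
  shows "formal_concept M (iconcept M C)"
  using assms
  by (induction C) (auto simp: is_interpretation_def
      intro: concept_meet_glb(1) concept_join_lub(1) formal_concept_box formal_concept_dia)

section \<open>The canonical model\<close>

text \<open>Only the names are read off from \<open>M\<close>'s own interpretation of individuals; this is what
  repairs a model that interprets the special individuals badly.\<close>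

primrec obj_value ::
    "('o, 'f, 'c, 'rb, 'rd, 'a, 'x) interp \<Rightarrow> ('o, 'c, 'rb, 'rd) obj \<Rightarrow> ('a, 'x) fconcept"
  and proper_obj_value ::
    "('o, 'f, 'c, 'rb, 'rd, 'a, 'x) interp \<Rightarrow> ('o, 'c, 'rb, 'rd) proper_obj \<Rightarrow> ('a, 'x) fconcept"
  where
  "obj_value M (ObjConcept C) = iconcept M C"
| "obj_value M (ObjProper b) = proper_obj_value M b"
| "proper_obj_value M (ObjName a) = obj_gen M (iobj M (ObjProper (ObjName a)))"
| "proper_obj_value M (ObjAdj R b) = concept_bdia M R (obj_value M b)"
| "proper_obj_value M (ObjDia R b) = concept_dia M R (proper_obj_value M b)"

primrec feat_value ::
    "('o, 'f, 'c, 'rb, 'rd, 'a, 'x) interp \<Rightarrow> ('f, 'c, 'rb, 'rd) feat \<Rightarrow> ('a, 'x) fconcept"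
  and proper_feat_value ::
    "('o, 'f, 'c, 'rb, 'rd, 'a, 'x) interp \<Rightarrow> ('f, 'c, 'rb, 'rd) proper_feat \<Rightarrow> ('a, 'x) fconcept"
  where
  "feat_value M (FeatConcept C) = iconcept M C"
| "feat_value M (FeatProper y) = proper_feat_value M y"
| "proper_feat_value M (FeatName x) = feat_gen M (ifeat M (FeatProper (FeatName x)))"
| "proper_feat_value M (FeatBox R y) = concept_box M R (proper_feat_value M y)"
| "proper_feat_value M (FeatAdj R y) = concept_bbox M R (feat_value M y)"

lemma obj_value_dia [simp]: "obj_value M (dia_obj R b) = concept_dia M R (obj_value M b)"
  by (cases b) simp_all

lemma obj_value_bdia [simp]: "obj_value M (bdia_obj R b) = concept_bdia M R (obj_value M b)"
  by (simp add: bdia_obj_def)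

lemma feat_value_box [simp]: "feat_value M (box_feat R y) = concept_box M R (feat_value M y)"
  by (cases y) simp_all

lemma feat_value_bbox [simp]: "feat_value M (bbox_feat R y) = concept_bbox M R (feat_value M y)"
  by (simp add: bbox_feat_def)

lemma formal_concept_obj_value:
  assumes "is_interpretation M"
  shows "formal_concept M (obj_value M b)"
proof -
  have "formal_concept M (obj_value M b)" and "formal_concept M (proper_obj_value M p)" for b p
    using assms
    by (induction b and p rule: obj.induct proper_obj.induct)
      (auto simp: is_interpretation_def formal_concept_iconcept
        intro: formal_concept_obj_gen formal_concept_bdia formal_concept_dia)
  then show ?thesis by blast
qed

lemma formal_concept_feat_value:
  assumes "is_interpretation M"
  shows "formal_concept M (feat_value M y)"
proof -
  have "formal_concept M (feat_value M y)" and "formal_concept M (proper_feat_value M p)" for y p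
    using assms
    by (induction y and p rule: feat.induct proper_feat.induct)
      (auto simp: is_interpretation_def formal_concept_iconcept
        intro: formal_concept_feat_gen formal_concept_bbox formal_concept_box)
  then show ?thesis by blast
qed

text \<open>The counterpart of \<open>c\<close> among the individuals. It need not be a formal concept of the
  canonical model unless \<open>c\<close> is the value of both an object and a feature, as the value of every
  LE-concept is.\<close>

definition polar_pair ::
  "('o, 'f, 'c, 'rb, 'rd, 'a, 'x) interp \<Rightarrow> ('a, 'x) fconcept \<Rightarrow>
   (('o, 'c, 'rb, 'rd) obj, ('f, 'c, 'rb, 'rd) feat) fconcept" where
  "polar_pair M c = ({b. concept_le (obj_value M b) c}, {y. concept_le c (feat_value M y)})"

definition canonical ::
  "('o, 'f, 'c, 'rb, 'rd, 'a, 'x) interp \<Rightarrow>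
   ('o, 'f, 'c, 'rb, 'rd, ('o, 'c, 'rb, 'rd) obj, ('f, 'c, 'rb, 'rd) feat) interp" where
  "canonical M =
    \<lparr>objects = UNIV, features = UNIV,
     incidence = {(b, y). concept_le (obj_value M b) (feat_value M y)},
     rbox = (\<lambda>R. {(b, y). concept_le (obj_value M b) (concept_box M R (feat_value M y))}),
     rdia = (\<lambda>R. {(y, b). concept_le (concept_dia M R (obj_value M b)) (feat_value M y)}),
     iobj = id, ifeat = id, iatom = (\<lambda>D. polar_pair M (iatom M D))\<rparr>"

lemma canonical_simps [simp]:
  "objects (canonical M) = UNIV" "features (canonical M) = UNIV"
  "(b, y) \<in> incidence (canonical M) \<longleftrightarrow> concept_le (obj_value M b) (feat_value M y)"
  "(b, y) \<in> rbox (canonical M) R \<longleftrightarrow>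
     concept_le (obj_value M b) (concept_box M R (feat_value M y))"
  "(y, b) \<in> rdia (canonical M) S \<longleftrightarrow>
     concept_le (concept_dia M S (obj_value M b)) (feat_value M y)"
  "iobj (canonical M) b = b" "ifeat (canonical M) y = y"
  "iatom (canonical M) D = polar_pair M (iatom M D)"
  by (simp_all add: canonical_def)

lemma up_canonical:
  "up (canonical M) B = {y. \<forall>b\<in>B. concept_le (obj_value M b) (feat_value M y)}"
  by (simp add: up_def rel1_def)

lemma down_canonical:
  "down (canonical M) Y = {b. \<forall>y\<in>Y. concept_le (obj_value M b) (feat_value M y)}"
  by (simp add: down_def rel0_def)

lemma stable_objs_polar:
  assumes "Y \<subseteq> features P"
  shows "stable_objs P (down P Y)"
  unfolding stable_objs_def
  by (intro conjI subset_antisym down_objects down_up_superset down_antimono up_down_superset assms)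

lemma stable_feats_polar:
  assumes "B \<subseteq> objects P"
  shows "stable_feats P (up P B)"
  unfolding stable_feats_def
  by (intro conjI subset_antisym up_features up_down_superset up_antimono down_up_superset assms)

text \<open>The witnesses \<open>a\<^sub>C\<close> and \<open>x\<^sub>C\<close> both have value \<open>C\<close>, so that a feature above all objects
  below \<open>C\<close> is already above \<open>C\<close>, and dually.\<close>

lemma up_polar_pair:
  "up (canonical M) (extension (polar_pair M (iconcept M C)))
     = intension (polar_pair M (iconcept M C))"
proof -
  have "concept_le (iconcept M C) (feat_value M y)"
    if "\<And>b. concept_le (obj_value M b) (iconcept M C)
            \<Longrightarrow> concept_le (obj_value M b) (feat_value M y)" for y
    using that[of "ObjConcept C"] by (simp add: concept_le_refl)
  then show ?thesis
    by (auto simp: up_canonical polar_pair_def intro: concept_le_trans)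
qed

lemma down_polar_pair:
  "down (canonical M) (intension (polar_pair M (iconcept M C)))
     = extension (polar_pair M (iconcept M C))"
proof -
  have "concept_le (obj_value M b) (iconcept M C)"
    if "\<And>y. concept_le (iconcept M C) (feat_value M y)
            \<Longrightarrow> concept_le (obj_value M b) (feat_value M y)" for b
    using that[of "FeatConcept C"] by (simp add: concept_le_refl)
  then show ?thesis
    by (auto simp: down_canonical polar_pair_def intro: concept_le_trans)
qed

text \<open>Each polar of a role relation is the \<open>I\<close>-polar of one individual: \<open>\<box>y\<close> and the black
  diamond of \<open>b\<close> for \<open>R\<^sub>\<box>\<close>, \<open>\<diamond>b\<close> and the black box of \<open>y\<close> for \<open>R\<^sub>\<diamond>\<close>.\<close>

lemma is_interpretation_canonical:
  assumes M: "is_interpretation M"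
  shows "is_interpretation (canonical M)"
proof -
  let ?N = "canonical M"
  have efc: "enriched_formal_context M" using M by (simp add: is_interpretation_def)
  note fc = formal_concept_obj_value[OF M] formal_concept_feat_value[OF M]
  have "rel0 UNIV (rbox ?N R) {y} = down ?N {box_feat R y}" for R y
    by (simp add: rel0_def down_canonical)
  moreover have "rel1 UNIV (rbox ?N R) {b} = up ?N {bdia_obj R b}" for R b
    by (simp add: rel1_def up_canonical bdia_box_adjoint[OF efc] fc)
  moreover have "rel0 UNIV (rdia ?N R) {b} = up ?N {dia_obj R b}" for R b
    by (simp add: rel0_def up_canonical)
  moreover have "rel1 UNIV (rdia ?N R) {y} = down ?N {bbox_feat R y}" for R y
    by (simp add: rel1_def down_canonical dia_bbox_adjoint[OF efc] fc)
  ultimately have "enriched_formal_context ?N"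
    by (simp add: enriched_formal_context_def formal_context_def box_compatible_def
        dia_compatible_def stable_objs_polar stable_feats_polar)
  moreover have "formal_concept ?N (polar_pair M (iatom M D))" for D
    using up_polar_pair[of M "Atom D"] down_polar_pair[of M "Atom D"]
    by (simp add: formal_concept_def)
  ultimately show ?thesis
    by (simp add: is_interpretation_def)
qed

lemma concept_le_meet_iff:
  "concept_le e (concept_meet P c d) \<longleftrightarrow> concept_le e c \<and> concept_le e d"
  by (auto simp: concept_le_def concept_meet_def)

lemma concept_join_le_iff:
  assumes "formal_concept P c" "formal_concept P d" "formal_concept P e"
  shows "concept_le (concept_join P c d) e \<longleftrightarrow> concept_le c e \<and> concept_le d e"
  using concept_join_lub[OF assms(1,2)] assms(3) concept_le_trans by blast

text \<open>For each connective one component of the concept is computed directly, for \<open>\<and>\<close> and \<open>\<or>\<close>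
  from the universal property of the operation in \<open>M\<close>, and the other is its polar, known from \<open>up_polar_pair\<close> and
  \<open>down_polar_pair\<close>. For \<open>[R]C\<close> the feature \<open>x\<^sub>C\<close> gives the strongest of the conditions
  \<open>b \<le> [R]y\<close> for \<open>C \<le> y\<close>, and for \<open>\<langle>R\<rangle>C\<close> so does the object \<open>a\<^sub>C\<close>.\<close>

lemma iconcept_canonical:
  assumes M: "is_interpretation M"
  shows "iconcept (canonical M) C = polar_pair M (iconcept M C)"
proof (induction C)
  case (Atom D)
  show ?case by simp
next
  case (And C1 C2)
  let ?c = "iconcept M (And C1 C2)"
  have ext: "extension (polar_pair M (iconcept M C1)) \<inter> extension (polar_pair M (iconcept M C2))
      = extension (polar_pair M ?c)"
    by (auto simp: polar_pair_def concept_le_meet_iff)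
  show ?case
    unfolding iconcept.simps(2)[of "canonical M"] And.IH concept_meet_def[of "canonical M"]
      ext up_polar_pair prod.collapse ..
next
  case (Or C1 C2)
  let ?c = "iconcept M (Or C1 C2)"
  have int: "intension (polar_pair M (iconcept M C1)) \<inter> intension (polar_pair M (iconcept M C2))
      = intension (polar_pair M ?c)"
    by (auto simp: polar_pair_def concept_join_le_iff formal_concept_iconcept[OF M]
        formal_concept_feat_value[OF M])
  show ?case
    unfolding iconcept.simps(3)[of "canonical M"] Or.IH concept_join_def[of "canonical M"]
      int down_polar_pair prod.collapse ..
next
  case (Dia R C)
  let ?c = "iconcept M (Dia R C)"
  have "concept_le (concept_dia M R (iconcept M C)) (feat_value M y)"
    if "\<And>b. concept_le (obj_value M b) (iconcept M C)
            \<Longrightarrow> concept_le (concept_dia M R (obj_value M b)) (feat_value M y)" for y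
    using that[of "ObjConcept C"] by (simp add: concept_le_refl)
  then have int: "rel0 (features (canonical M)) (rdia (canonical M) R)
        (extension (polar_pair M (iconcept M C))) = intension (polar_pair M ?c)"
    by (auto simp: rel0_def polar_pair_def intro: concept_le_trans concept_dia_mono)
  show ?case
    unfolding iconcept.simps(4)[of "canonical M"] Dia.IH concept_dia_def[of "canonical M"]
      int Let_def down_polar_pair prod.collapse ..
next
  case (Box R C)
  let ?c = "iconcept M (Box R C)"
  have "concept_le (obj_value M b) (concept_box M R (iconcept M C))"
    if "\<And>y. concept_le (iconcept M C) (feat_value M y)
            \<Longrightarrow> concept_le (obj_value M b) (concept_box M R (feat_value M y))" for b
    using that[of "FeatConcept C"] by (simp add: concept_le_refl)
  then have ext: "rel0 (objects (canonical M)) (rbox (canonical M) R)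
        (intension (polar_pair M (iconcept M C))) = extension (polar_pair M ?c)"
    by (auto simp: rel0_def polar_pair_def intro: concept_le_trans[OF _ concept_box_mono[OF
        formal_concept_iconcept[OF M] formal_concept_feat_value[OF M]]])
  show ?case
    unfolding iconcept.simps(5)[of "canonical M"] Box.IH concept_box_def[of "canonical M"]
      ext Let_def up_polar_pair prod.collapse ..
qed

section \<open>Satisfaction in the canonical model\<close>

lemma sat_fact_canonical:
  assumes M: "is_interpretation M"
  shows "sat_fact (canonical M) (ObjIn b C) \<longleftrightarrow> concept_le (obj_value M b) (iconcept M C)"
    and "sat_fact (canonical M) (FeatIn y C) \<longleftrightarrow> concept_le (iconcept M C) (feat_value M y)"
  using M by (simp_all add: iconcept_canonical polar_pair_def)

lemma sat_fact_canonical_input: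
  assumes M: "is_interpretation M" and "input_fact \<alpha>"
  shows "sat_fact (canonical M) \<alpha> \<longleftrightarrow> sat_fact M \<alpha>"
proof -
  have efc: "enriched_formal_context M"
    and io: "\<And>b. iobj M b \<in> objects M" and ix: "\<And>y. ifeat M y \<in> features M"
    using M by (auto simp: is_interpretation_def)
  have inc: "a \<in> down M {x} \<longleftrightarrow> (a, x) \<in> incidence M" if "a \<in> objects M" for a x
    using that by (simp add: down_def rel0_def)
  have gen: "concept_le (obj_gen M a) (feat_gen M x) \<longleftrightarrow> (a, x) \<in> incidence M"
    if "a \<in> objects M" "x \<in> features M" for a x
    using obj_gen_le[OF that(1) formal_concept_feat_gen[OF that(2)]] inc[OF that(1)]
    by (simp add: feat_gen_def)
  show ?thesis
    using assms(2)
    by (cases \<alpha>) (auto simp: input_obj_def input_feat_def iconcept_canonical[OF M] polar_pair_def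
        obj_gen_le feat_gen_ge formal_concept_iconcept[OF M] gen io ix
        obj_gen_le_box_feat_gen[OF efc] dia_obj_gen_le_feat_gen[OF efc])
qed

lemma sat_canonical_input:
  assumes "is_interpretation M" "input_term t"
  shows "sat (canonical M) t \<longleftrightarrow> sat M t"
  using assms by (cases t) (simp_all add: sat_fact_canonical_input)

text \<open>Once all terms are translated into inequalities between values, each rule is an instance
  of transitivity, monotonicity, a universal property or an adjunction; the negative and
  appending rules hold because \<open>a\<^sub>C\<close> and \<open>x\<^sub>C\<close> have value \<open>C\<close>.\<close>

lemma expand_sound:
  assumes M: "is_interpretation M"
    and "expand \<A> \<B>" and "\<forall>t\<in>\<A>. sat (canonical M) t"
  shows "\<forall>t\<in>\<B>. sat (canonical M) t"
proof -
  have efc: "enriched_formal_context M" using M by (simp add: is_interpretation_def)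
  note fc = formal_concept_iconcept[OF M] formal_concept_obj_value[OF M]
    formal_concept_feat_value[OF M]
  note sat_in = sat_fact_canonical[OF M]
  have sat_A: "sat (canonical M) t" if "t \<in> \<A>" for t using assms(3) that by blast
  note [simp del] = sat_fact.simps(4,5)
  note [simp] = sat_in concept_le_refl concept_le_meet_iff concept_join_le_iff[OF fc(1) fc(1) fc(3)]
    bdia_box_adjoint[OF efc fc(2) fc(3)] dia_bbox_adjoint[OF efc fc(2) fc(3), symmetric]
  show ?thesis
    using assms(2)
  proof cases
    case (create C)
    then show ?thesis using sat_A by auto
  next
    case (basic b C y)
    then show ?thesis using sat_A[OF basic(2)] sat_A[OF basic(3)] sat_A
      by (auto intro: concept_le_trans)
  next
    case (and_A b C1 C2)
    then show ?thesis using sat_A[OF and_A(2)] sat_A by auto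
  next
    case (or_X y C1 C2)
    then show ?thesis using sat_A[OF or_X(2)] sat_A by auto
  next
    case (box b R C y)
    then show ?thesis using sat_A[OF box(2)] sat_A[OF box(3)] sat_A
      by (auto intro: concept_le_trans[OF _ concept_box_mono[OF fc(1) fc(3)]])
  next
    case (dia y R C b)
    then show ?thesis using sat_A[OF dia(2)] sat_A[OF dia(3)] sat_A
      by (auto intro: concept_le_trans concept_dia_mono)
  next
    case (compat_box b R y)
    then show ?thesis using sat_A[OF compat_box(2)] sat_A by auto
  next
    case (compat_bbox b R y)
    then show ?thesis using sat_A[OF compat_bbox(2)] sat_A by auto
  next
    case (compat_dia R b y)
    then show ?thesis using sat_A[OF compat_dia(2)] sat_A by auto
  next
    case (compat_bdia R b y)
    then show ?thesis using sat_A[OF compat_bdia(2)] sat_A by auto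
  next
    case (and_A_inv b C1 C2)
    then show ?thesis using sat_A[OF and_A_inv(2)] sat_A[OF and_A_inv(3)] sat_A by auto
  next
    case (or_X_inv y C1 C2)
    then show ?thesis using sat_A[OF or_X_inv(2)] sat_A[OF or_X_inv(3)] sat_A by auto
  next
    case (adj_box b R y)
    then show ?thesis using sat_A[OF adj_box(2)] sat_A by auto
  next
    case (adj_dia y R b)
    then show ?thesis using sat_A[OF adj_dia(2)] sat_A by auto
  next
    case (neg_obj b C)
    then show ?thesis using sat_A[OF neg_obj(2)] sat_A by auto
  next
    case (neg_feat x C)
    then show ?thesis using sat_A[OF neg_feat(2)] sat_A by auto
  next
    case (append_obj b C)
    then show ?thesis using sat_A[OF append_obj(2)] sat_A by auto
  next
    case (append_feat C y)
    then show ?thesis using sat_A[OF append_feat(2)] sat_A by auto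
  qed
qed

lemma expand_mono: "expand \<A> \<B> \<Longrightarrow> \<A> \<subseteq> \<B>"
  by (induction rule: expand.induct) auto

lemma expand_star_mono: "expand\<^sup>*\<^sup>* \<A> \<B> \<Longrightarrow> \<A> \<subseteq> \<B>"
  by (induction rule: rtranclp_induct) (auto dest: expand_mono)

theorem theorem3:
  fixes \<A>\<^sub>0 \<A> \<A>' :: "('o, 'f, 'c, 'rb::finite, 'rd::finite) abox"
  assumes "input_abox \<A>\<^sub>0" and "expand\<^sup>*\<^sup>* \<A>\<^sub>0 \<A>"
    and "consistent TYPE('a) TYPE('x) \<A>"
    and "expand \<A> \<A>'"
  shows "consistent TYPE(('o, 'c, 'rb, 'rd) obj) TYPE(('f, 'c, 'rb, 'rd) feat) \<A>'"
proof -
  obtain M :: "('o, 'f, 'c, 'rb, 'rd, 'a, 'x) interp"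
    where M: "is_interpretation M" and sat_M: "\<forall>t\<in>\<A>. sat M t"
    using assms(3) unfolding consistent_def by blast
  have "\<forall>t\<in>\<A>\<^sub>0. sat (canonical M) t"
    using sat_M expand_star_mono[OF assms(2)] assms(1) sat_canonical_input[OF M]
    unfolding input_abox_def by blast
  with assms(2) have "\<forall>t\<in>\<A>. sat (canonical M) t"
    by (induction rule: rtranclp_induct) (use expand_sound[OF M] in blast)+
  then have "\<forall>t\<in>\<A>'. sat (canonical M) t"
    using expand_sound[OF M assms(4)] by blast
  then show ?thesis
    using is_interpretation_canonical[OF M] unfolding consistent_def by blast
qed

end
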